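(* The $\mathbb{S}$-collection $\mathsf{relscpx}$ of relative simplicial complexes, equipped with the join compositions $\{\circ_k^\ast\}$, forms a unital operad with unit $(\mathrm{pt},\{\emptyset\})$.
   Context: For $n\ge1$ let $[n]=\{1,\dots,n\}$. A simplicial complex on $[n]$ is a family of subsets of $[n]$ closed under taking subsets; the empty family $\emptyset$ and the complex $\{\emptyset\}$ are allowed, as are ghost vertices. A relative simplicial complex on $[n]$ is a pair $(K,L)$ of simplicial complexes on $[n]$ with $L\subseteq K$; $\mathsf{relscpx}(n)$ is the set of these ($n\ge1$), with $\mathbb{S}_n$ acting by relabelling. $\mathrm{pt}=\{\emptyset,\{1\}\}$ on $[1]$; in the unit, $\{\emptyset\}$ is the complex on $[1]$. The join of $K_1$ on $[n_1]$ and $K_2$ on $[n_2]$ is the complex $K_1\ast K_2=\{I_1\sqcup(I_2+n_1)\mid I_1\in K_1,I_2\in K_2\}$ on $[n_1+n_2]$, where $I+\ell=\{i+\ell\mid i\in I\}$ (so a join with the empty family is empty). For a simplicial complex $K$ on $[n]$, $k\in[n]$ and a relative simplicial complex $(M,N)$ on $[m]$, define the simplicial complex on $[n+m-1]$ $$K\triangleleft_k^\ast(M,N)=\bigcup_{I\in K}P_1^I\ast\cdots\ast P_n^I,$$ where for $j\neq k$, $P_j^I=\mathrm{pt}$ if $j\in I$ and $P_j^I=\{\emptyset\}$ (on $[1]$) if $j\notin I$, while $P_k^I=M$ if $k\in I$ and $P_k^I=N$ if $k\notin I$. The join composition of $(K,L)$ on $[n]$ with $(M,N)$ on $[m]$ at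 $k\in[n]$ is $(K,L)\circ_k^\ast(M,N)=(K\triangleleft_k^\ast(M,N),\,L\triangleleft_k^\ast(M,N))$. An operad here is a symmetric set operad given by partial compositions satisfying the sequential, parallel, unit and equivariance axioms. *)

theory Defs
  imports Main "HOL-Combinatorics.Permutations"
begin

(* The partial composition of two permutations.  The inputs of mu \<circ>_i nu are the
   inputs of mu other than i together with the block i..i+m-1 of inputs of nu, where m is
   the arity of nu.  Inputs q of mu go to \<sigma> q, with those beyond \<sigma> i moved up by
   m - 1 to make room for the block, which starts at \<sigma> i and is permuted by \<tau>. *)
definition perm_comp :: "nat \<Rightarrow> nat \<Rightarrow> (nat \<Rightarrow> nat) \<Rightarrow> (nat \<Rightarrow> nat) \<Rightarrow> nat \<Rightarrow> nat" where
  "perm_comp m i \<sigma> \<tau> p =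
    (let place = (\<lambda>q. if q < \<sigma> i then q else q + (m - 1)) in
     if p < i then place (\<sigma> p)
     else if p < i + m then \<sigma> i + \<tau> (p + 1 - i) - 1
     else place (\<sigma> (p - (m - 1))))"

(* Arities are at least 1.  Symmetric groups act on the left: act n \<sigma> x moves input j of x
   to position \<sigma> j.  The usual right action is x . \<sigma> = act n (inv \<sigma>) x.
   Since the carriers P n need not be disjoint, act and comp take the arities as arguments:
   comp n m k x y is x \<circ>_k y for x in P n and y in P m. *)
locale unital_operad =
  fixes P :: "nat \<Rightarrow> 'a set"
    and act :: "nat \<Rightarrow> (nat \<Rightarrow> nat) \<Rightarrow> 'a \<Rightarrow> 'a"
    and comp :: "nat \<Rightarrow> nat \<Rightarrow> nat \<Rightarrow> 'a \<Rightarrow> 'a \<Rightarrow> 'a"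
    and unit :: 'a
  assumes act_closed:
      "\<lbrakk>1 \<le> n; \<sigma> permutes {1..n}; x \<in> P n\<rbrakk> \<Longrightarrow> act n \<sigma> x \<in> P n"
    and act_id: "\<lbrakk>1 \<le> n; x \<in> P n\<rbrakk> \<Longrightarrow> act n id x = x"
    and act_compose:
      "\<lbrakk>1 \<le> n; \<sigma> permutes {1..n}; \<tau> permutes {1..n}; x \<in> P n\<rbrakk>
        \<Longrightarrow> act n (\<sigma> \<circ> \<tau>) x = act n \<sigma> (act n \<tau> x)"
    and comp_closed:
      "\<lbrakk>1 \<le> n; 1 \<le> m; k \<in> {1..n}; x \<in> P n; y \<in> P m\<rbrakk> \<Longrightarrow> comp n m k x y \<in> P (n + m - 1)"
    and sequential:
      "\<lbrakk>1 \<le> l; 1 \<le> m; 1 \<le> n; i \<in> {1..l}; j \<in> {1..m}; x \<in> P l; y \<in> P m; z \<in> P n\<rbrakk>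
        \<Longrightarrow> comp (l + m - 1) n (i - 1 + j) (comp l m i x y) z
          = comp l (m + n - 1) i x (comp m n j y z)"
    and parallel:
      "\<lbrakk>1 \<le> l; 1 \<le> m; 1 \<le> n; i \<in> {1..l}; k \<in> {1..l}; i < k; x \<in> P l; y \<in> P m; z \<in> P n\<rbrakk>
        \<Longrightarrow> comp (l + m - 1) n (k - 1 + m) (comp l m i x y) z
          = comp (l + n - 1) m i (comp l n k x z) y"
    and unit_closed: "unit \<in> P 1"
    and unit_left: "\<lbrakk>1 \<le> n; x \<in> P n\<rbrakk> \<Longrightarrow> comp 1 n 1 unit x = x"
    and unit_right: "\<lbrakk>1 \<le> n; k \<in> {1..n}; x \<in> P n\<rbrakk> \<Longrightarrow> comp n 1 k x unit = x"
    and equivariance: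
      "\<lbrakk>1 \<le> n; 1 \<le> m; k \<in> {1..n}; \<sigma> permutes {1..n}; \<tau> permutes {1..m}; x \<in> P n; y \<in> P m\<rbrakk>
        \<Longrightarrow> comp n m (\<sigma> k) (act n \<sigma> x) (act m \<tau> y)
          = act (n + m - 1) (perm_comp m k \<sigma> \<tau>) (comp n m k x y)"

(* Both the empty family and {{}} are complexes, and singletons need not be faces. *)
definition scpx :: "nat \<Rightarrow> nat set set set" where
  "scpx n = {K. K \<subseteq> Pow {1..n} \<and> (\<forall>I\<in>K. \<forall>J. J \<subseteq> I \<longrightarrow> J \<in> K)}"

definition relscpx :: "nat \<Rightarrow> (nat set set \<times> nat set set) set" where
  "relscpx n = {(K, L). K \<in> scpx n \<and> L \<in> scpx n \<and> L \<subseteq> K}"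

definition relabel ::
    "(nat \<Rightarrow> nat) \<Rightarrow> nat set set \<times> nat set set \<Rightarrow> nat set set \<times> nat set set" where
  "relabel \<sigma> = (\<lambda>(K, L). ((`) \<sigma> ` K, (`) \<sigma> ` L))"

definition pt :: "nat set set" where
  "pt = {{}, {1}}"

(* The first argument is the number of vertices of the ground set of K1, which K1 itself
   does not determine. *)
definition join :: "nat \<Rightarrow> nat set set \<Rightarrow> nat set set \<Rightarrow> nat set set" where
  "join n1 K1 K2 = {I1 \<union> (\<lambda>i. i + n1) ` I2 | I1 I2. I1 \<in> K1 \<and> I2 \<in> K2}"

(* Iterated join of complexes paired with the sizes of their ground sets; the empty join
   {{}} on the empty ground set is neutral for join. *)
fun joins :: "(nat \<times> nat set set) list \<Rightarrow> nat set set" where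
  "joins [] = {{}}"
| "joins ((n, K) # Ps) = join n K (joins Ps)"

(* K on [n], (M, N) on [m] *)
definition join_subst ::
    "nat \<Rightarrow> nat \<Rightarrow> nat \<Rightarrow> nat set set \<Rightarrow> nat set set \<times> nat set set \<Rightarrow> nat set set" where
  "join_subst n m k K = (\<lambda>(M, N).
    \<Union>I\<in>K. joins (map (\<lambda>j. if j = k then (m, if k \<in> I then M else N)
                          else (1, if j \<in> I then pt else {{}})) [1..<n + 1]))"

definition join_comp ::
    "nat \<Rightarrow> nat \<Rightarrow> nat \<Rightarrow> nat set set \<times> nat set set \<Rightarrow> nat set set \<times> nat set set
      \<Rightarrow> nat set set \<times> nat set set" where
  "join_comp n m k = (\<lambda>(K, L) MN. (join_subst n m k K MN, join_subst n m k L MN))"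

end

theory Submission
  imports Defs
begin

text \<open>
  A face of the composite \<open>K \<triangleleft>\<^sub>k (M, N)\<close> is best understood through its two traces: a set \<open>F\<close> of
  vertices of the composite has an inner part \<open>B\<close>, its trace on the block of \<open>m\<close> vertices that
  replaces \<open>k\<close>, and an outer part \<open>A\<close>, its trace on the remaining vertices of \<open>[n]\<close>.  In the
  union over \<open>I \<in> K\<close> of joins, the factor at \<open>j \<noteq> k\<close> only says that \<open>j \<in> A\<close> implies \<open>j \<in> I\<close>, and
  the factor at \<open>k\<close> says that \<open>B\<close> lies in \<open>M\<close> or in \<open>N\<close>, according to whether \<open>k \<in> I\<close>.  As \<open>K\<close> is
  closed under subsets, the least possible \<open>I\<close> suffices, and so
  \<open>F \<in> K \<triangleleft>\<^sub>k (M, N) \<longleftrightarrow> (A \<union> {k} \<in> K \<and> B \<in> M) \<or> (A \<in> K \<and> B \<in> N)\<close>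
  (lemma \<open>mem_join_subst\<close>).

  Every axiom follows from this formula.  For the two associativity axioms, both sides cut \<open>F\<close>
  into the same three parts (lemmas \<open>outer_outer_nested\<close> to \<open>inner_inner_nested\<close> and
  \<open>outer_outer_disjoint\<close> to \<open>inner_outer_right\<close>), and inserting the formula
  into itself gives the same Boolean combination of membership statements, by distributivity of
  conjunction over disjunction.  For the left unit, the outer part of a face is empty, so the
  condition reads \<open>B \<in> M \<or> B \<in> N\<close> for the composite with \<open>pt\<close> and \<open>B \<in> N\<close> for the one with \<open>{{}}\<close>;
  for the right unit, the inner part only records whether \<open>k \<in> F\<close>.  For equivariance, the
  composite permutation acts on the outer part as \<open>\<sigma>\<close> and on the inner part as \<open>\<tau>\<close>; since it is a
  bijection, relabelling a complex amounts to taking preimages of the candidate faces.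
\<close>

section \<open>Outer and inner parts of a vertex set\<close>

definition slot :: "nat \<Rightarrow> nat \<Rightarrow> nat \<Rightarrow> nat" where
  "slot k m j = (if j < k then j else j + (m - 1))"

text \<open>
  No bound \<open>j \<le> n\<close> is imposed in the outer part, so that it does not depend on \<open>n\<close>; the bound
  comes for free as soon as the outer part is a face of a complex on \<open>[n]\<close>.
\<close>

definition outer :: "nat \<Rightarrow> nat \<Rightarrow> nat set \<Rightarrow> nat set" where
  "outer k m F = {j. j \<noteq> k \<and> slot k m j \<in> F}"

definition inner :: "nat \<Rightarrow> nat \<Rightarrow> nat set \<Rightarrow> nat set" where
  "inner k m F = {b \<in> {1..m}. k - 1 + b \<in> F}"

lemma slot_or_block_cases:
  assumes "1 \<le> k" "1 \<le> m"
  obtains (slot) j where "j \<noteq> k" "p = slot k m j"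
  | (block) b where "b \<in> {1..m}" "p = k - 1 + b"
proof -
  consider "p < k" | "k \<le> p" "p < k + m" | "k + m \<le> p" by linarith
  then show thesis
  proof cases
    case 1
    then show thesis using slot[of p] by (simp add: slot_def)
  next
    case 2
    then have "p + 1 - k \<in> {1..m}" "p = k - 1 + (p + 1 - k)" using assms by auto
    then show thesis by (rule block)
  next
    case 3
    then show thesis using slot[of "p - (m - 1)"] assms by (simp add: slot_def)
  qed
qed

lemma slot_neq_block: "1 \<le> k \<Longrightarrow> b \<in> {1..m} \<Longrightarrow> j \<noteq> k \<Longrightarrow> slot k m j \<noteq> k - 1 + b"
  by (auto simp: slot_def)

lemma notin_outer: "k \<notin> outer k m F"
  by (simp add: outer_def)

lemma outer_mono: "F \<subseteq> G \<Longrightarrow> outer k m F \<subseteq> outer k m G"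
  by (auto simp: outer_def)

lemma inner_mono: "F \<subseteq> G \<Longrightarrow> inner k m F \<subseteq> inner k m G"
  by (auto simp: inner_def)

lemma range_of_outer:
  assumes k: "k \<in> {1..n}" and m: "1 \<le> m" and outer: "outer k m F \<subseteq> {1..n}"
  shows "F \<subseteq> {1..n + m - 1}"
proof
  fix p assume "p \<in> F"
  have k1: "1 \<le> k" using k by simp
  consider (slot) j where "j \<noteq> k" "p = slot k m j" | (block) b where "b \<in> {1..m}" "p = k - 1 + b"
    using slot_or_block_cases[OF k1 m] by blast
  then show "p \<in> {1..n + m - 1}"
  proof cases
    case (slot j)
    then have "j \<in> outer k m F" using \<open>p \<in> F\<close> by (simp add: outer_def)
    then have "j \<in> {1..n}" using outer by blast
    then show ?thesis using slot m by (auto simp: slot_def)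
  next
    case (block b)
    then show ?thesis using k by auto
  qed
qed

section \<open>Faces of a join composition\<close>

lemma scpx_down: "K \<in> scpx n \<Longrightarrow> I \<in> K \<Longrightarrow> J \<subseteq> I \<Longrightarrow> J \<in> K"
  by (auto simp: scpx_def)

lemma scpx_bound: "K \<in> scpx n \<Longrightarrow> I \<in> K \<Longrightarrow> I \<subseteq> {1..n}"
  by (auto simp: scpx_def)

lemma mem_join:
  assumes K1: "K1 \<subseteq> Pow {1..n}" and K2: "\<forall>I\<in>K2. 0 \<notin> I"
  shows "F \<in> join n K1 K2 \<longleftrightarrow>
    0 \<notin> F \<and> F \<inter> {1..n} \<in> K1 \<and> {b. 1 \<le> b \<and> n + b \<in> F} \<in> K2"
proof
  assume "F \<in> join n K1 K2"
  then obtain I1 I2 where F: "F = I1 \<union> (\<lambda>i. i + n) ` I2" and I: "I1 \<in> K1" "I2 \<in> K2"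
    by (auto simp: join_def)
  have I1: "I1 \<subseteq> {1..n}" and I2: "0 \<notin> I2" using I K1 K2 by auto
  have "F \<inter> {1..n} = I1" using F I1 I2 by (auto intro: Suc_leI gr0I)
  moreover have "{b. 1 \<le> b \<and> n + b \<in> F} = I2"
    using F I1 I2 by (force simp: image_iff intro: Suc_leI gr0I)
  moreover have "0 \<notin> F" using F I1 I2 by auto
  ultimately show "0 \<notin> F \<and> F \<inter> {1..n} \<in> K1 \<and> {b. 1 \<le> b \<and> n + b \<in> F} \<in> K2"
    using I by simp
next
  assume *: "0 \<notin> F \<and> F \<inter> {1..n} \<in> K1 \<and> {b. 1 \<le> b \<and> n + b \<in> F} \<in> K2"
  have "F = (F \<inter> {1..n}) \<union> (\<lambda>i. i + n) ` {b. 1 \<le> b \<and> n + b \<in> F}"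
  proof (intro set_eqI iffI)
    fix p assume p: "p \<in> F"
    then have "p \<noteq> 0" using * by metis
    show "p \<in> (F \<inter> {1..n}) \<union> (\<lambda>i. i + n) ` {b. 1 \<le> b \<and> n + b \<in> F}"
    proof (cases "p \<le> n")
      case True
      then show ?thesis using p \<open>p \<noteq> 0\<close> by simp
    next
      case False
      then have "p = (p - n) + n" "p - n \<in> {b. 1 \<le> b \<and> n + b \<in> F}" using p by auto
      then show ?thesis by blast
    qed
  qed (auto simp: add.commute)
  then show "F \<in> join n K1 K2" using * unfolding join_def by blast
qed

text \<open>
  A face of an iterated join is a vertex set whose trace on each block is a face of the
  corresponding factor; block \<open>i\<close> starts after the total size of the earlier factors.
\<close>

lemma mem_joins:
  assumes "\<forall>(s, K) \<in> set Ps. K \<subseteq> Pow {1..s}"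
  shows "F \<in> joins Ps \<longleftrightarrow> F \<subseteq> {1..sum_list (map fst Ps)} \<and>
    (\<forall>i < length Ps.
      {b \<in> {1..fst (Ps ! i)}. sum_list (take i (map fst Ps)) + b \<in> F} \<in> snd (Ps ! i))"
  using assms
proof (induction Ps arbitrary: F)
  case Nil
  then show ?case by auto
next
  case (Cons P Ps)
  obtain s K where P: "P = (s, K)" by (cases P)
  let ?T = "sum_list (map fst Ps)"
  let ?G = "{b. 1 \<le> b \<and> s + b \<in> F}"
  have IH: "\<And>G. G \<in> joins Ps \<longleftrightarrow> G \<subseteq> {1..?T} \<and>
    (\<forall>i < length Ps.
      {b \<in> {1..fst (Ps ! i)}. sum_list (take i (map fst Ps)) + b \<in> G} \<in> snd (Ps ! i))"
    using Cons by auto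
  have "\<forall>I \<in> joins Ps. 0 \<notin> I" using IH by fastforce
  then have "F \<in> joins (P # Ps) \<longleftrightarrow> 0 \<notin> F \<and> F \<inter> {1..s} \<in> K \<and> ?G \<in> joins Ps"
    using Cons.prems P mem_join[of K s "joins Ps" F] by simp
  moreover have "0 \<notin> F \<and> ?G \<subseteq> {1..?T} \<longleftrightarrow> F \<subseteq> {1..s + ?T}"
  proof
    assume *: "0 \<notin> F \<and> ?G \<subseteq> {1..?T}"
    show "F \<subseteq> {1..s + ?T}"
    proof
      fix p assume p: "p \<in> F"
      show "p \<in> {1..s + ?T}"
      proof (cases "p \<le> s")
        case True
        then show ?thesis using p * by (auto intro: Suc_leI gr0I)
      next
        case False
        then have "p - s \<in> ?G" using p by simp
        then have "p - s \<in> {1..?T}" using * by blast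
        then show ?thesis by auto
      qed
    qed
  qed (auto simp: subset_iff)
  moreover have "F \<inter> {1..s} = {b \<in> {1..s}. b \<in> F}" by auto
  moreover have "{b \<in> {1..fst (Ps ! i)}. sum_list (take i (map fst Ps)) + b \<in> ?G}
      = {b \<in> {1..fst (Ps ! i)}. s + sum_list (take i (map fst Ps)) + b \<in> F}" for i
    by (auto simp: add.assoc)
  ultimately show ?case
    unfolding length_Cons All_less_Suc2 using IH[of ?G] P by auto
qed

lemma sum_list_sizes_before:
  assumes "1 \<le> k" "1 \<le> m"
  shows "sum_list (map (\<lambda>j. if j = k then m else 1) [1..<i + 1])
    = (if i < k then i else i + m - 1)"
proof (induction i)
  case 0
  then show ?case using assms by simp
next
  case (Suc i)
  have "[1..<Suc i + 1] = [1..<i + 1] @ [Suc i]" by simp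
  then show ?case using Suc assms by (simp del: upt_Suc)
qed

text \<open>
  The faces attached to a fixed \<open>I\<close>: for \<open>j \<noteq> k\<close> the factor at \<open>j\<close> has one vertex, which may be
  used exactly when \<open>j \<in> I\<close>.
\<close>

lemma mem_subst_joins:
  assumes k: "k \<in> {1..n}" and m: "1 \<le> m" and M: "M \<subseteq> Pow {1..m}" and N: "N \<subseteq> Pow {1..m}"
  shows "F \<in> joins (map (\<lambda>j. if j = k then (m, if k \<in> I then M else N)
                          else (1, if j \<in> I then pt else {{}})) [1..<n + 1])
    \<longleftrightarrow> F \<subseteq> {1..n + m - 1} \<and> outer k m F \<subseteq> I \<and> inner k m F \<in> (if k \<in> I then M else N)"
proof -
  let ?f = "\<lambda>j. if j = k then (m, if k \<in> I then M else N)
                          else (1, if j \<in> I then pt else {{}})"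
  let ?s = "\<lambda>j. if j = k then m else 1"
  let ?Ps = "map ?f [1..<n + 1]"
  have sizes: "map fst ?Ps = map ?s [1..<n + 1]" by auto
  have total: "sum_list (map fst ?Ps) = n + m - 1"
    unfolding sizes using k m by (subst sum_list_sizes_before) auto
  have before: "sum_list (take i (map fst ?Ps)) = (if i < k then i else i + m - 1)"
    if "i < n" for i
    unfolding sizes take_map using that k m sum_list_sizes_before[of k m i]
    by (simp add: take_upt del: upt_Suc)
  have nth: "?Ps ! i = ?f (Suc i)" if "i < n" for i
    using that by (simp del: upt_Suc)
  have factor: "{b \<in> {1..fst (?Ps ! i)}. sum_list (take i (map fst ?Ps)) + b \<in> F} \<in> snd (?Ps ! i)
    \<longleftrightarrow> (if Suc i = k then inner k m F \<in> (if k \<in> I then M else N)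
        else slot k m (Suc i) \<in> F \<longrightarrow> Suc i \<in> I)" if i: "i < n" for i
  proof (cases "Suc i = k")
    case True
    then have "k - 1 = i" "i < k" by auto
    then show ?thesis using nth[OF i] before[OF i] True by (simp add: inner_def)
  next
    case False
    have pos: "(if i < k then i else i + m - 1) + 1 = slot k m (Suc i)"
      using False m by (auto simp: slot_def)
    have "{b \<in> {1..1}. (if i < k then i else i + m - 1) + b \<in> F}
        = (if slot k m (Suc i) \<in> F then {1} else {})"
      unfolding pos[symmetric] by auto
    then show ?thesis
      unfolding before[OF i] nth[OF i] using False by (auto simp: pt_def)
  qed
  have "\<forall>(s, K) \<in> set ?Ps. K \<subseteq> Pow {1..s}"
    using M N by (force simp: pt_def split: if_splits)
  from mem_joins[OF this, of F]
  have "F \<in> joins ?Ps \<longleftrightarrow> F \<subseteq> {1..n + m - 1} \<and>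
      (\<forall>i<n. if Suc i = k then inner k m F \<in> (if k \<in> I then M else N)
        else slot k m (Suc i) \<in> F \<longrightarrow> Suc i \<in> I)"
    unfolding total using factor by (simp del: upt_Suc)
  also have "\<dots> \<longleftrightarrow> F \<subseteq> {1..n + m - 1} \<and>
      (\<forall>j\<in>{1..n}. if j = k then inner k m F \<in> (if k \<in> I then M else N)
        else slot k m j \<in> F \<longrightarrow> j \<in> I)"
  proof -
    have all_Suc: "(\<forall>i<n. Q (Suc i)) \<longleftrightarrow> (\<forall>j\<in>{1..n}. Q j)" for Q
      unfolding image_Suc_lessThan[symmetric] by auto
    show ?thesis unfolding all_Suc[symmetric] ..
  qed
  also have "\<dots> \<longleftrightarrow> F \<subseteq> {1..n + m - 1} \<and> outer k m F \<subseteq> I \<and>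
      inner k m F \<in> (if k \<in> I then M else N)"
  proof -
    have "j \<in> {1..n}" if "F \<subseteq> {1..n + m - 1}" "slot k m j \<in> F" for j
    proof -
      have "slot k m j \<in> {1..n + m - 1}" using that by blast
      then show ?thesis using k m by (auto simp: slot_def split: if_splits)
    qed
    then show ?thesis using k by (auto simp: outer_def)
  qed
  finally show ?thesis .
qed

text \<open>
  Given the traces, the least \<open>I\<close> witnessing membership is the outer part, with \<open>k\<close> added if the
  first component of the pair is to be used at \<open>k\<close>.
\<close>

lemma mem_join_subst:
  assumes k: "k \<in> {1..n}" and m: "1 \<le> m" and K: "K \<in> scpx n" and MN: "(M, N) \<in> relscpx m"
  shows "F \<in> join_subst n m k K (M, N) \<longleftrightarrow>
    insert k (outer k m F) \<in> K \<and> inner k m F \<in> M \<or> outer k m F \<in> K \<and> inner k m F \<in> N"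
    (is "_ \<longleftrightarrow> ?R")
proof -
  have "M \<subseteq> Pow {1..m}" "N \<subseteq> Pow {1..m}"
    using MN by (auto simp: relscpx_def scpx_def)
  then have *: "F \<in> join_subst n m k K (M, N) \<longleftrightarrow>
    (\<exists>I\<in>K. F \<subseteq> {1..n + m - 1} \<and> outer k m F \<subseteq> I \<and> inner k m F \<in> (if k \<in> I then M else N))"
    unfolding join_subst_def prod.case UN_iff by (simp only: mem_subst_joins[OF k m])
  show ?thesis
  proof
    assume "F \<in> join_subst n m k K (M, N)"
    then obtain I where I: "I \<in> K" "outer k m F \<subseteq> I" "inner k m F \<in> (if k \<in> I then M else N)"
      using * by auto
    show ?R
    proof (cases "k \<in> I")
      case True
      then have "insert k (outer k m F) \<subseteq> I" using I by simp
      then show ?thesis using scpx_down[OF K I(1)] I True by auto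
    next
      case False
      then show ?thesis using scpx_down[OF K I(1,2)] I by auto
    qed
  next
    assume R: ?R
    then have "outer k m F \<subseteq> {1..n}" using scpx_bound[OF K] by blast
    then have "F \<subseteq> {1..n + m - 1}" by (rule range_of_outer[OF k m])
    then show "F \<in> join_subst n m k K (M, N)"
      unfolding * using R notin_outer[of k m F] by (metis insertI1 subset_insertI order_refl)
  qed
qed

lemma join_subst_closed:
  assumes k: "k \<in> {1..n}" and m: "1 \<le> m" and K: "K \<in> scpx n" and y: "y \<in> relscpx m"
  shows "join_subst n m k K y \<in> scpx (n + m - 1)"
proof -
  obtain M N where y': "y = (M, N)" by (cases y)
  have MN: "(M, N) \<in> relscpx m" and M: "M \<in> scpx m" and N: "N \<in> scpx m"
    using y unfolding y' by (auto simp: relscpx_def)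
  note mem = mem_join_subst[OF k m K MN]
  have "F \<subseteq> {1..n + m - 1}" if "F \<in> join_subst n m k K (M, N)" for F
    using that range_of_outer[OF k m, of F] scpx_bound[OF K] unfolding mem by blast
  moreover have "G \<in> join_subst n m k K (M, N)"
    if "F \<in> join_subst n m k K (M, N)" "G \<subseteq> F" for F G
    using that(1) outer_mono[OF that(2), of k m] inner_mono[OF that(2), of k m]
      scpx_down[OF K] scpx_down[OF M] scpx_down[OF N] unfolding mem
    by (meson insert_mono)
  ultimately show ?thesis unfolding y' scpx_def by blast
qed

lemma join_subst_mono: "L \<subseteq> K \<Longrightarrow> join_subst n m k L y \<subseteq> join_subst n m k K y"
  unfolding join_subst_def by (cases y) auto

lemma join_comp_closed:
  assumes "k \<in> {1..n}" "1 \<le> m" "x \<in> relscpx n" "y \<in> relscpx m"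
  shows "join_comp n m k x y \<in> relscpx (n + m - 1)"
proof -
  obtain K L where x: "x = (K, L)" by (cases x)
  then have "K \<in> scpx n" "L \<in> scpx n" "L \<subseteq> K" using assms(3) by (auto simp: relscpx_def)
  then show ?thesis
    using join_subst_closed[OF assms(1,2) _ assms(4)] join_subst_mono[of L K]
    by (simp add: x relscpx_def join_comp_def)
qed

section \<open>Sequential axiom\<close>

text \<open>
  Here \<open>z\<close> replaces vertex \<open>j\<close> of \<open>y\<close>, which replaces vertex \<open>i\<close> of \<open>x\<close>.  The block of \<open>z\<close> lies inside
  the block of the composite of \<open>y\<close> and \<open>z\<close>, so the outermost part, the part from \<open>y\<close> and the
  innermost part of a vertex set do not depend on which block is split off first.
\<close>

context
  fixes i j m n :: nat
  assumes i: "1 \<le> i" and j: "j \<in> {1..m}" and n: "1 \<le> n"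
begin

lemma slot_nested: "p \<noteq> i \<Longrightarrow> slot (i - 1 + j) n (slot i m p) = slot i (m + n - 1) p"
  using i j n by (auto simp: slot_def)

lemma slot_block_nested: "slot (i - 1 + j) n (i - 1 + b) = i - 1 + slot j n b"
  using i j n by (auto simp: slot_def)

lemma slot_in_block_iff: "b \<noteq> j \<Longrightarrow> slot j n b \<in> {1..m + n - 1} \<longleftrightarrow> b \<in> {1..m}"
  using j n by (auto simp: slot_def)

lemma outer_outer_nested: "outer i m (outer (i - 1 + j) n F) = outer i (m + n - 1) F"
  using slot_nested slot_neq_block[OF i j] by (auto simp: outer_def)

lemma inner_outer_nested: "inner i m (outer (i - 1 + j) n F) = outer j n (inner i (m + n - 1) F)"
  unfolding outer_def inner_def mem_Collect_eq slot_block_nested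
  using slot_in_block_iff by auto

lemma inner_inner_nested: "inner (i - 1 + j) n F = inner j n (inner i (m + n - 1) F)"
proof -
  have "i - 1 + j - 1 + b = i - 1 + (j - 1 + b)" for b using j by simp
  moreover have "j - 1 + b \<in> {1..m + n - 1}" if "b \<in> {1..n}" for b using that j by auto
  ultimately show ?thesis unfolding inner_def by (auto simp: add.assoc)
qed

lemma outer_insert_nested: "outer i m (insert (i - 1 + j) F) = outer i m F"
  using i j by (auto simp: outer_def slot_def)

lemma inner_insert_nested: "inner i m (insert (i - 1 + j) F) = insert j (inner i m F)"
  using i j by (auto simp: inner_def)

end

lemma join_subst_sequential:
  assumes l: "i \<in> {1..l}" and j: "j \<in> {1..m}" and n: "1 \<le> n"
    and K: "K \<in> scpx l" and y: "y \<in> relscpx m" and z: "z \<in> relscpx n"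
  shows "join_subst (l + m - 1) n (i - 1 + j) (join_subst l m i K y) z
    = join_subst l (m + n - 1) i K (join_comp m n j y z)"
proof -
  obtain M N where y': "y = (M, N)" by (cases y)
  obtain P Q where z': "z = (P, Q)" by (cases z)
  have m: "1 \<le> m" and i: "1 \<le> i" using j l by auto
  have mn: "1 \<le> m + n - 1" and ij: "i - 1 + j \<in> {1..l + m - 1}" using m n l j by auto
  have M: "M \<in> scpx m" and N: "N \<in> scpx m" using y unfolding y' by (auto simp: relscpx_def)
  have yz: "(join_subst m n j M (P, Q), join_subst m n j N (P, Q)) \<in> relscpx (m + n - 1)"
    using join_comp_closed[OF j n y z] unfolding y' z' join_comp_def by simp
  note rules = mem_join_subst[OF ij n join_subst_closed[OF l m K y] z[unfolded z'], unfolded y']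
    mem_join_subst[OF l m K y[unfolded y']] mem_join_subst[OF l mn K yz]
    mem_join_subst[OF j n M z[unfolded z']] mem_join_subst[OF j n N z[unfolded z']]
    outer_insert_nested[OF i j n] inner_insert_nested[OF i j n] outer_outer_nested[OF i j n]
    inner_outer_nested[OF i j n] inner_inner_nested[OF i j n]
  show ?thesis
    unfolding y' z' join_comp_def prod.case set_eq_iff rules by blast
qed

section \<open>Parallel axiom\<close>

text \<open>
  The blocks replacing \<open>i < k\<close> are disjoint, so splitting one off leaves the other intact.  Once
  \<open>i\<close> has become a block of \<open>m\<close> vertices, the old vertex \<open>k\<close> sits at \<open>k - 1 + m\<close>, whereas
  replacing \<open>k\<close> leaves \<open>i\<close> in place.
\<close>

context
  fixes i k m n :: nat
  assumes i: "1 \<le> i" and ik: "i < k" and m: "1 \<le> m" and n: "1 \<le> n"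
begin

lemma outer_outer_disjoint:
  "outer i m (outer (k - 1 + m) n F) = outer k n (outer i m F)"
proof -
  have "slot i m p = k - 1 + m \<longleftrightarrow> p = k" "slot k n p = i \<longleftrightarrow> p = i"
    if "p \<noteq> i \<or> p \<noteq> k" for p
    using that i ik m n by (auto simp: slot_def)
  moreover have "slot (k - 1 + m) n (slot i m p) = slot i m (slot k n p)"
    if "p \<noteq> i" "p \<noteq> k" for p
    using that i ik m n by (auto simp: slot_def)
  ultimately show ?thesis using ik unfolding outer_def by auto
qed

lemma inner_outer_left: "inner i m (outer (k - 1 + m) n F) = inner i m F"
proof -
  have "i - 1 + b \<noteq> k - 1 + m \<and> slot (k - 1 + m) n (i - 1 + b) = i - 1 + b"
    if "b \<in> {1..m}" for b
    using that i ik by (auto simp: slot_def)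
  then show ?thesis unfolding outer_def inner_def by auto
qed

lemma inner_outer_right: "inner k n (outer i m F) = inner (k - 1 + m) n F"
proof -
  have "k - 1 + b \<noteq> i \<and> slot i m (k - 1 + b) = k - 1 + m - 1 + b" if "b \<in> {1..n}" for b
    using that i ik m by (auto simp: slot_def)
  then show ?thesis unfolding outer_def inner_def by auto
qed

lemma outer_insert_disjoint:
  "outer i m (insert (k - 1 + m) F) = insert k (outer i m F)"
  "outer k n (insert i F) = insert i (outer k n F)"
  using i ik m n by (auto simp: outer_def slot_def split: if_splits)

lemma inner_insert_disjoint:
  "inner i m (insert (k - 1 + m) F) = inner i m F"
  "inner k n (insert i F) = inner k n F"
  using i ik m n by (auto simp: inner_def)

end

lemma join_subst_parallel:
  assumes l: "i \<in> {1..l}" "k \<in> {1..l}" and ik: "i < k" and m: "1 \<le> m" and n: "1 \<le> n"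
    and K: "K \<in> scpx l" and y: "y \<in> relscpx m" and z: "z \<in> relscpx n"
  shows "join_subst (l + m - 1) n (k - 1 + m) (join_subst l m i K y) z
    = join_subst (l + n - 1) m i (join_subst l n k K z) y"
proof -
  obtain M N where y': "y = (M, N)" by (cases y)
  obtain P Q where z': "z = (P, Q)" by (cases z)
  have i: "1 \<le> i" using l by auto
  have km: "k - 1 + m \<in> {1..l + m - 1}" and il: "i \<in> {1..l + n - 1}" using m n l by auto
  note rules =
    mem_join_subst[OF km n join_subst_closed[OF l(1) m K y] z[unfolded z'], unfolded y']
    mem_join_subst[OF il m join_subst_closed[OF l(2) n K z] y[unfolded y'], unfolded z']
    mem_join_subst[OF l(1) m K y[unfolded y']] mem_join_subst[OF l(2) n K z[unfolded z']]
    outer_insert_disjoint[OF i ik m n] inner_insert_disjoint[OF i ik m n]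
    outer_outer_disjoint[OF i ik m n] inner_outer_left[OF i ik m n]
    inner_outer_right[OF i ik m n] insert_commute[of i k]
  show ?thesis
    unfolding y' z' set_eq_iff rules by blast
qed

section \<open>Unit axioms\<close>

lemma unit_relscpx: "(pt, {{}}) \<in> relscpx 1"
  by (auto simp: relscpx_def scpx_def pt_def)

lemma join_comp_unit_left:
  assumes n: "1 \<le> n" and x: "x \<in> relscpx n"
  shows "join_comp 1 n 1 (pt, {{}}) x = x"
proof -
  obtain K L where x': "x = (K, L)" by (cases x)
  have K: "K \<in> scpx n" and L: "L \<in> scpx n" using x unfolding x' by (auto simp: relscpx_def)
  have units: "pt \<in> scpx 1" "{{}} \<in> scpx 1" by (auto simp: scpx_def pt_def)
  have bound: "I \<subseteq> {1..n}" if "I \<in> K \<or> I \<in> L" for I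
    using that scpx_bound[OF K] scpx_bound[OF L] by blast
  have "outer 1 n F = {} \<and> inner 1 n F = F" if "F \<subseteq> {1..n}" for F
  proof -
    have "0 \<notin> F" and up: "\<And>p. p \<in> F \<Longrightarrow> p \<le> n" using that by auto
    have "slot 1 n j \<notin> F" if "j \<noteq> 1" for j
      using that n up[of "slot 1 n j"] \<open>0 \<notin> F\<close> by (auto simp: slot_def)
    then have "outer 1 n F = {}" by (auto simp: outer_def)
    moreover have "inner 1 n F = F" using that by (auto simp: inner_def)
    ultimately show ?thesis by simp
  qed
  moreover have "F \<subseteq> {1..n}" if "outer 1 n F \<subseteq> {1}" for F
    using range_of_outer[of 1 1 n F] n that by simp
  \<comment> \<open>The outer part lists every vertex outside the block, so it is empty only for \<open>F \<subseteq> [n]\<close>; the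
    bound \<open>{1}\<close> is the ground set of the unit, in which the outer part has to be a face.\<close>
  ultimately have traces: "outer 1 n F \<subseteq> {1} \<longleftrightarrow> F \<subseteq> {1..n}"
    "F \<subseteq> {1..n} \<Longrightarrow> outer 1 n F = {} \<and> inner 1 n F = F" for F
    by blast+
  have "F \<in> join_subst 1 n 1 pt (K, L) \<longleftrightarrow> F \<in> K" for F
  proof -
    have "F \<in> join_subst 1 n 1 pt (K, L) \<longleftrightarrow>
        outer 1 n F \<subseteq> {1} \<and> (inner 1 n F \<in> K \<or> outer 1 n F = {} \<and> inner 1 n F \<in> L)"
      using mem_join_subst[OF _ n units(1) x[unfolded x'], of 1 F] notin_outer[of 1 n F]
      by (auto simp: pt_def)
    moreover have "L \<subseteq> K" using x unfolding x' by (auto simp: relscpx_def)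
    ultimately show ?thesis using traces[of F] bound[of F] by auto
  qed
  moreover have "F \<in> join_subst 1 n 1 {{}} (K, L) \<longleftrightarrow> F \<in> L" for F
    using mem_join_subst[OF _ n units(2) x[unfolded x'], of 1 F] traces[of F] bound[of F]
    by auto
  ultimately show ?thesis unfolding x' join_comp_def by auto
qed

lemma join_subst_unit_right:
  assumes k: "k \<in> {1..n}" and K: "K \<in> scpx n"
  shows "join_subst n 1 k K (pt, {{}}) = K"
proof -
  have "outer k 1 F = F - {k}" for F by (auto simp: outer_def slot_def)
  moreover have "inner k 1 F = (if k \<in> F then {1} else {})" for F
    using k by (auto simp: inner_def)
  ultimately have "F \<in> join_subst n 1 k K (pt, {{}}) \<longleftrightarrow>
      (if k \<in> F then F \<in> K else insert k F \<in> K \<or> F \<in> K)" for F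
    using mem_join_subst[OF k _ K unit_relscpx, of F] by (auto simp: pt_def insert_absorb)
  moreover have "F \<in> K" if "insert k F \<in> K" for F
    using scpx_down[OF K that] by blast
  ultimately show ?thesis by (auto split: if_splits)
qed

section \<open>Equivariance\<close>

lemma relabel_closed:
  assumes "\<sigma> permutes {1..n}" "x \<in> relscpx n"
  shows "relabel \<sigma> x \<in> relscpx n"
proof -
  have "(`) \<sigma> ` K \<in> scpx n" if K: "K \<in> scpx n" for K
  proof -
    have "J \<in> (`) \<sigma> ` K" if "I \<in> K" "J \<subseteq> \<sigma> ` I" for I J
      using that scpx_down[OF K \<open>I \<in> K\<close>] by (auto elim!: subset_imageE)
    moreover have "\<sigma> ` I \<subseteq> {1..n}" if "I \<in> K" for I
      using scpx_bound[OF K that] permutes_image[OF assms(1)] by blast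
    ultimately show ?thesis unfolding scpx_def by blast
  qed
  then show ?thesis using assms(2) by (auto simp: relscpx_def relabel_def)
qed

lemma mem_image_image_iff:
  assumes "bij f"
  shows "F \<in> (`) f ` K \<longleftrightarrow> f -` F \<in> K"
proof
  assume "F \<in> (`) f ` K"
  then show "f -` F \<in> K" using inj_vimage_image_eq[OF bij_is_inj[OF assms]] by auto
next
  assume "f -` F \<in> K"
  moreover have "F = f ` (f -` F)" using surj_image_vimage_eq[OF bij_is_surj[OF assms]] by simp
  ultimately show "F \<in> (`) f ` K" by (rule rev_image_eqI)
qed

text \<open>
  The composite permutation carries the decomposition at \<open>k\<close> to the decomposition at \<open>\<sigma> k\<close>,
  acting as \<open>\<sigma>\<close> on the outer vertices and as \<open>\<tau>\<close> inside the block.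
\<close>

lemma perm_comp_slot:
  assumes "inj \<sigma>" "1 \<le> m" "j \<noteq> k"
  shows "perm_comp m k \<sigma> \<tau> (slot k m j) = slot (\<sigma> k) m (\<sigma> j)"
  using assms by (auto simp: perm_comp_def slot_def)

lemma perm_comp_block:
  assumes "1 \<le> k" "1 \<le> \<sigma> k" "\<tau> permutes {1..m}" "b \<in> {1..m}"
  shows "perm_comp m k \<sigma> \<tau> (k - 1 + b) = \<sigma> k - 1 + \<tau> b"
  using assms by (auto simp: perm_comp_def)

text \<open>
  Bijectivity on all of \<open>\<nat>\<close>, rather than on \<open>[n + m - 1]\<close>, is what lets
  \<open>mem_image_image_iff\<close> apply to arbitrary candidate faces.
\<close>

lemma perm_comp_inverse:
  assumes k: "k \<in> {1..n}" and m: "1 \<le> m" and \<sigma>: "\<sigma> permutes {1..n}" and \<tau>: "\<tau> permutes {1..m}"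
  shows "perm_comp m (\<sigma> k) (inv \<sigma>) (inv \<tau>) (perm_comp m k \<sigma> \<tau> p) = p"
proof -
  have k1: "1 \<le> k" using k by simp
  have \<sigma>k: "1 \<le> \<sigma> k" using permutes_in_image[OF \<sigma>, of k] k by simp
  have inv: "inv \<sigma> permutes {1..n}" "inv \<tau> permutes {1..m}"
    using \<sigma> \<tau> by (auto intro: permutes_inv)
  note [simp] = permutes_inverses(2)[OF \<sigma>] permutes_inverses(2)[OF \<tau>]
  consider (slot) j where "j \<noteq> k" "p = slot k m j" | (block) b where "b \<in> {1..m}" "p = k - 1 + b"
    using slot_or_block_cases[OF k1 m] by blast
  then show ?thesis
  proof cases
    case (slot j)
    then have "\<sigma> j \<noteq> \<sigma> k" using permutes_inj[OF \<sigma>] by (simp add: inj_eq)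
    then show ?thesis
      using slot m perm_comp_slot[OF permutes_inj[OF \<sigma>]] perm_comp_slot[OF permutes_inj[OF inv(1)]]
      by simp
  next
    case (block b)
    then have "\<tau> b \<in> {1..m}" using permutes_in_image[OF \<tau>] by blast
    then show ?thesis
      using block k1 \<sigma>k perm_comp_block[of k \<sigma> \<tau> m, OF k1 \<sigma>k \<tau>] perm_comp_block[of "\<sigma> k" "inv \<sigma>" "inv \<tau>" m "\<tau> b"] inv
      by simp
  qed
qed

lemma bij_perm_comp:
  assumes k: "k \<in> {1..n}" and m: "1 \<le> m" and \<sigma>: "\<sigma> permutes {1..n}" and \<tau>: "\<tau> permutes {1..m}"
  shows "bij (perm_comp m k \<sigma> \<tau>)"
proof -
  have "\<sigma> k \<in> {1..n}" using permutes_in_image[OF \<sigma>] k by blast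
  then have "perm_comp m k \<sigma> \<tau> (perm_comp m (\<sigma> k) (inv \<sigma>) (inv \<tau>) p) = p" for p
    using perm_comp_inverse[of "\<sigma> k" n m "inv \<sigma>" "inv \<tau>" p] m permutes_inv[OF \<sigma>] permutes_inv[OF \<tau>]
    by (simp add: permutes_inverses(2)[OF \<sigma>] permutes_inv_inv[OF \<sigma>] permutes_inv_inv[OF \<tau>])
  then show ?thesis
    using perm_comp_inverse[OF assms]
    by (intro o_bij[where g = "perm_comp m (\<sigma> k) (inv \<sigma>) (inv \<tau>)"]) (simp_all add: fun_eq_iff)
qed

lemma join_subst_equivariant:
  assumes k: "k \<in> {1..n}" and m: "1 \<le> m" and \<sigma>: "\<sigma> permutes {1..n}" and \<tau>: "\<tau> permutes {1..m}"
    and K: "K \<in> scpx n" and y: "y \<in> relscpx m" and K\<sigma>: "(`) \<sigma> ` K \<in> scpx n"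
  shows "join_subst n m (\<sigma> k) ((`) \<sigma> ` K) (relabel \<tau> y)
    = (`) (perm_comp m k \<sigma> \<tau>) ` join_subst n m k K y"
proof -
  let ?\<pi> = "perm_comp m k \<sigma> \<tau>"
  obtain M N where y': "y = (M, N)" by (cases y)
  have y\<tau>: "((`) \<tau> ` M, (`) \<tau> ` N) \<in> relscpx m"
    using relabel_closed[OF \<tau> y] unfolding y' relabel_def by simp
  have k1: "1 \<le> k" and \<sigma>k: "\<sigma> k \<in> {1..n}" "1 \<le> \<sigma> k"
    using k permutes_in_image[OF \<sigma>, of k] by auto
  have \<sigma>_eq: "\<sigma> j = \<sigma> k \<longleftrightarrow> j = k" for j
    by (rule inj_eq[OF permutes_inj[OF \<sigma>]])
  have outer: "outer k m (?\<pi> -` F) = \<sigma> -` outer (\<sigma> k) m F" for F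
  proof -
    have "?\<pi> (slot k m j) = slot (\<sigma> k) m (\<sigma> j)" if "j \<noteq> k" for j
      using permutes_inj[OF \<sigma>] m that by (rule perm_comp_slot)
    then show ?thesis unfolding outer_def by (auto simp: \<sigma>_eq)
  qed
  have inner: "inner k m (?\<pi> -` F) = \<tau> -` inner (\<sigma> k) m F" for F
  proof -
    have block: "?\<pi> (k - 1 + b) = \<sigma> k - 1 + \<tau> b" if "b \<in> {1..m}" for b
      using k1 \<sigma>k(2) \<tau> that by (rule perm_comp_block[of k \<sigma> \<tau> m])
    have "b \<in> inner k m (?\<pi> -` F) \<longleftrightarrow> \<tau> b \<in> inner (\<sigma> k) m F" for b
      unfolding inner_def mem_Collect_eq vimage_eq permutes_in_image[OF \<tau>]
      using block[of b] by (auto simp only:)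
    then show ?thesis unfolding set_eq_iff vimage_eq by blast
  qed
  have insert: "\<sigma> -` insert (\<sigma> k) A = insert k (\<sigma> -` A)" for A
    by (auto simp: \<sigma>_eq)
  have "F \<in> join_subst n m (\<sigma> k) ((`) \<sigma> ` K) ((`) \<tau> ` M, (`) \<tau> ` N)
      \<longleftrightarrow> ?\<pi> -` F \<in> join_subst n m k K (M, N)" for F
    unfolding mem_join_subst[OF \<sigma>k(1) m K\<sigma> y\<tau>] mem_join_subst[OF k m K y[unfolded y']]
      mem_image_image_iff[OF permutes_bij[OF \<sigma>]] mem_image_image_iff[OF permutes_bij[OF \<tau>]]
      outer inner insert ..
  then show ?thesis
    unfolding y' relabel_def prod.case set_eq_iff
      mem_image_image_iff[OF bij_perm_comp[OF k m \<sigma> \<tau>]] by simp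
qed

lemma join_comp_equivariant:
  assumes k: "k \<in> {1..n}" and m: "1 \<le> m" and \<sigma>: "\<sigma> permutes {1..n}" and \<tau>: "\<tau> permutes {1..m}"
    and x: "x \<in> relscpx n" and y: "y \<in> relscpx m"
  shows "join_comp n m (\<sigma> k) (relabel \<sigma> x) (relabel \<tau> y)
    = relabel (perm_comp m k \<sigma> \<tau>) (join_comp n m k x y)"
proof -
  obtain K L where x': "x = (K, L)" by (cases x)
  have "K \<in> scpx n" "L \<in> scpx n" "(`) \<sigma> ` K \<in> scpx n" "(`) \<sigma> ` L \<in> scpx n"
    using x relabel_closed[OF \<sigma> x] unfolding x' by (auto simp: relscpx_def relabel_def)
  then show ?thesis
    using join_subst_equivariant[OF k m \<sigma> \<tau> _ y]
    unfolding x' by (simp add: join_comp_def relabel_def[of \<sigma>] relabel_def[of "perm_comp m k \<sigma> \<tau>"])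
qed

section \<open>The operad of relative simplicial complexes\<close>

theorem proposition4p13:
  "unital_operad relscpx (\<lambda>_. relabel) join_comp (pt, {{}})"
proof
  show "relabel \<sigma> x \<in> relscpx n" if "\<sigma> permutes {1..n}" "x \<in> relscpx n" for n \<sigma> x
    using that by (rule relabel_closed)
  show "relabel id x = x" for x
    by (cases x) (auto simp: relabel_def)
  show "relabel (\<sigma> \<circ> \<tau>) x = relabel \<sigma> (relabel \<tau> x)" for \<sigma> \<tau> x
    by (cases x) (simp add: relabel_def image_image image_comp)
  show "join_comp n m k x y \<in> relscpx (n + m - 1)"
    if "1 \<le> m" "k \<in> {1..n}" "x \<in> relscpx n" "y \<in> relscpx m" for n m k x y
    using join_comp_closed that by blast
  show "join_comp (l + m - 1) n (i - 1 + j) (join_comp l m i x y) z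
      = join_comp l (m + n - 1) i x (join_comp m n j y z)"
    if "1 \<le> n" "i \<in> {1..l}" "j \<in> {1..m}" "x \<in> relscpx l" "y \<in> relscpx m" "z \<in> relscpx n"
    for l m n i j x y z
    using that join_subst_sequential[OF that(2,3,1) _ that(5,6)]
    by (cases x) (simp add: join_comp_def relscpx_def)
  show "join_comp (l + m - 1) n (k - 1 + m) (join_comp l m i x y) z
      = join_comp (l + n - 1) m i (join_comp l n k x z) y"
    if "1 \<le> m" "1 \<le> n" "i \<in> {1..l}" "k \<in> {1..l}" "i < k"
      "x \<in> relscpx l" "y \<in> relscpx m" "z \<in> relscpx n" for l m n i k x y z
    using that(6) join_subst_parallel[OF that(3,4,5,1,2) _ that(7,8)]
    by (cases x) (simp add: join_comp_def relscpx_def)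
  show "(pt, {{}}) \<in> relscpx 1" by (rule unit_relscpx)
  show "join_comp 1 n 1 (pt, {{}}) x = x" if "1 \<le> n" "x \<in> relscpx n" for n x
    using that by (rule join_comp_unit_left)
  show "join_comp n 1 k x (pt, {{}}) = x" if "k \<in> {1..n}" "x \<in> relscpx n" for n k x
    using that join_subst_unit_right by (cases x) (auto simp: join_comp_def relscpx_def)
  show "join_comp n m (\<sigma> k) (relabel \<sigma> x) (relabel \<tau> y)
      = relabel (perm_comp m k \<sigma> \<tau>) (join_comp n m k x y)"
    if "1 \<le> m" "k \<in> {1..n}" "\<sigma> permutes {1..n}" "\<tau> permutes {1..m}"
      "x \<in> relscpx n" "y \<in> relscpx m" for n m k \<sigma> \<tau> x y
    using join_comp_equivariant that by blast
qed

end
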